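(* Let $w>0$, let $\alpha(s)=(x(s),z(s))$ be a plane curve parametrized by arc length, and consider the surface $$\phi(s,t)=(x(s)\cos(wt)+z(s)\sin(wt),\ t,\ -x(s)\sin(wt)+z(s)\cos(wt)).$$ The surface $\phi$ is flat (Gauss curvature identically zero) if and only if either (i) the TreadmillSled of the curve $\alpha$ is a point in the $y$-axis different from the origin (in this case the surface is a cylinder), or (ii) the TreadmillSled of $\alpha$ is contained in a vertical semi-line (half-line) that starts at a point in the $x$-axis different from the origin. Moreover, in case (ii) the functions $x$ and $z$ can be explicitly computed and they are, with real constants $a\neq 0$ and $b$, $$x(s)=\frac a2\cos\frac{2\sqrt{as+b}}{a}+\sqrt{as+b}\,\sin\frac{2\sqrt{as+b}}{a},\qquad z(s)=\sqrt{as+b}\,\cos\frac{2\sqrt{as+b}}{a}-\frac a2\sin\frac{2\sqrt{as+b}}{a}.$$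
   Context: TreadmillSled: given a regular plane curve $\alpha$, its TreadmillSled is the trace of the origin when the curve (together with the plane containing it) rolls on a treadmill located at the origin and aligned along the $x$-axis. Precisely, for $\alpha$ parametrized by arc length and each $s$, let $T_s:\mathbb{R}^2\to\mathbb{R}^2$ be the orientation-preserving isometry that takes $\alpha(s)$ to $(0,0)$ and whose linear part takes $\alpha'(s)$ to $(1,0)$; the TreadmillSled of $\alpha$ is the curve $s\mapsto T_s(0,0)$.
   Formalization: In (ii) the formulas for x, z hold up to a rotation about the origin and, for an upward half-line, with s replaced by -s (rotated or reversed copies refute the literal claim); in (i) the surface is an open piece of a round cylinder, all of it if s ranges over R. *)

theory Defs
  imports "HOL-Analysis.Analysis"
begin

section \<open>Plane curves and their TreadmillSled\<close>

text \<open>\<open>C\<^sup>2\<close> is the regularity that the Gauss curvature of the surfaces below needs.\<close>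

definition C2_curve_on :: "real set \<Rightarrow> (real \<Rightarrow> real^2) \<Rightarrow> bool" where
  "C2_curve_on I \<alpha> \<longleftrightarrow>
     (\<exists>\<alpha>' \<alpha>''. (\<forall>s\<in>I. (\<alpha> has_vector_derivative \<alpha>' s) (at s) \<and>
                        (\<alpha>' has_vector_derivative \<alpha>'' s) (at s)) \<and>
              continuous_on I \<alpha>'')"

definition arc_length_curve_on :: "real set \<Rightarrow> (real \<Rightarrow> real^2) \<Rightarrow> bool" where
  "arc_length_curve_on I \<alpha> \<longleftrightarrow>
     C2_curve_on I \<alpha> \<and> (\<forall>s\<in>I. norm (vector_derivative \<alpha> (at s)) = 1)"

text \<open>The orientation preserving isometries of the plane are the maps \<open>v \<mapsto> Q v + c\<close> with
  \<open>Q\<close> a rotation matrix. The description below determines the map uniquely where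
  \<open>\<alpha>\<close> has unit speed (see \<open>treadmill_sled_eq\<close>).\<close>

definition treadmill_isometry :: "(real \<Rightarrow> real^2) \<Rightarrow> real \<Rightarrow> real^2 \<Rightarrow> real^2" where
  "treadmill_isometry \<alpha> s =
     (THE T. \<exists>Q c. rotation_matrix Q \<and> T = (\<lambda>v. Q *v v + c) \<and> T (\<alpha> s) = 0 \<and>
                   Q *v vector_derivative \<alpha> (at s) = vector [1, 0])"

definition treadmill_sled :: "(real \<Rightarrow> real^2) \<Rightarrow> real \<Rightarrow> real^2" where
  "treadmill_sled \<alpha> s = treadmill_isometry \<alpha> s 0"

lemma treadmill_isometry_eq:
  assumes u: "vector_derivative \<alpha> (at s) = u" and n: "norm u = 1"
  shows "treadmill_isometry \<alpha> s =
           (\<lambda>v. vector [(v - \<alpha> s) \<bullet> u, (v - \<alpha> s) \<bullet> vector [- u$2, u$1]])"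
proof -
  have n2: "u$1 * u$1 + u$2 * u$2 = 1"
    using n by (simp add: norm_eq_1 inner_vec_def sum_2)
  define Q :: "real^2^2" where "Q = vector [u, vector [- u$2, u$1]]"
  define F :: "real^2 \<Rightarrow> real^2" where
    "F = (\<lambda>v. vector [(v - \<alpha> s) \<bullet> u, (v - \<alpha> s) \<bullet> vector [- u$2, u$1]])"
  show ?thesis
    unfolding treadmill_isometry_def u F_def [symmetric]
  proof (rule the_equality)
    have "rotation_matrix Q"
      using n2 by (simp add: rotation_matrix_def orthogonal_matrix Q_def det_2 vec_eq_iff forall_2
          matrix_matrix_mult_def transpose_def mat_def sum_2 algebra_simps)
    moreover have "F = (\<lambda>v. Q *v v + - (Q *v \<alpha> s))"
      by (auto simp: F_def Q_def vec_eq_iff forall_2 matrix_vector_mult_def inner_vec_def sum_2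
          algebra_simps)
    moreover have "F (\<alpha> s) = 0"
      by (simp add: F_def vec_eq_iff forall_2)
    moreover have "Q *v u = vector [1, 0]"
      using n2 by (simp add: Q_def vec_eq_iff forall_2 matrix_vector_mult_def sum_2)
    ultimately show "\<exists>Q c. rotation_matrix Q \<and> F = (\<lambda>v. Q *v v + c) \<and> F (\<alpha> s) = 0 \<and>
        Q *v u = vector [1, 0]"
      by blast
  next
    fix T :: "real^2 \<Rightarrow> real^2"
    assume "\<exists>Q c. rotation_matrix Q \<and> T = (\<lambda>v. Q *v v + c) \<and> T (\<alpha> s) = 0 \<and>
        Q *v u = vector [1, 0]"
    then obtain R c where R: "rotation_matrix R" and T: "T = (\<lambda>v. R *v v + c)"
      and T0: "T (\<alpha> s) = 0" and Ru: "R *v u = vector [1, 0]"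
      by blast
    have "u = transpose R *v (R *v u)"
      using R by (simp add: rotation_matrix_def orthogonal_matrix matrix_vector_mul_assoc)
    also have "\<dots> = R $ 1"
      unfolding Ru by (simp add: vec_eq_iff forall_2 matrix_vector_mult_def transpose_def sum_2)
    finally have R1: "R $ 1 = u" ..
    have d: "u$1 * R$2$2 - u$2 * R$2$1 = 1"
      using R by (simp add: rotation_matrix_def det_2 R1)
    have o: "R$2$1 * u$1 + R$2$2 * u$2 = 0"
      using arg_cong [OF Ru, of "\<lambda>x. x$2"] by (simp add: matrix_vector_mult_def sum_2)
    have R21: "R$2$1 = - u$2" and R22: "R$2$2 = u$1"
      using d o n2 by algebra+
    have R2: "R $ 2 = vector [- u$2, u$1]"
      by (simp add: vec_eq_iff forall_2 R21 R22)
    have "c = - (R *v \<alpha> s)"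
      using T0 by (simp add: T eq_neg_iff_add_eq_0 add.commute)
    then show "T = F"
      by (auto simp: T F_def vec_eq_iff forall_2 matrix_vector_mult_def inner_vec_def sum_2
          R1 R2 algebra_simps)
  qed
qed

lemma treadmill_sled_eq:
  assumes "vector_derivative \<alpha> (at s) = u" "norm u = 1"
  shows "treadmill_sled \<alpha> s = vector [- (\<alpha> s \<bullet> u), - (\<alpha> s \<bullet> vector [- u$2, u$1])]"
  by (simp add: treadmill_sled_def treadmill_isometry_eq [OF assms])

text \<open>The vertical half-line that starts at \<open>(c, 0)\<close>, upwards for \<open>\<sigma> = 1\<close> and downwards
  for \<open>\<sigma> = -1\<close>.\<close>

definition vertical_half_line :: "real \<Rightarrow> real \<Rightarrow> (real^2) set" where
  "vertical_half_line c \<sigma> = {vector [c, \<sigma> * r] | r. 0 \<le> r}"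


section \<open>Gauss curvature of a parametrized surface\<close>

definition pd1 :: "(real \<Rightarrow> real \<Rightarrow> real^3) \<Rightarrow> real \<Rightarrow> real \<Rightarrow> real^3" where
  "pd1 \<phi> s t = vector_derivative (\<lambda>s. \<phi> s t) (at s)"

definition pd2 :: "(real \<Rightarrow> real \<Rightarrow> real^3) \<Rightarrow> real \<Rightarrow> real \<Rightarrow> real^3" where
  "pd2 \<phi> s t = vector_derivative (\<lambda>t. \<phi> s t) (at t)"

definition unit_normal :: "(real \<Rightarrow> real \<Rightarrow> real^3) \<Rightarrow> real \<Rightarrow> real \<Rightarrow> real^3" where
  "unit_normal \<phi> s t = sgn (cross3 (pd1 \<phi> s t) (pd2 \<phi> s t))"

definition gauss_curvature :: "(real \<Rightarrow> real \<Rightarrow> real^3) \<Rightarrow> real \<Rightarrow> real \<Rightarrow> real" where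
  "gauss_curvature \<phi> s t =
     (let E = pd1 \<phi> s t \<bullet> pd1 \<phi> s t;
          F = pd1 \<phi> s t \<bullet> pd2 \<phi> s t;
          G = pd2 \<phi> s t \<bullet> pd2 \<phi> s t;
          e = pd1 (pd1 \<phi>) s t \<bullet> unit_normal \<phi> s t;
          f = pd2 (pd1 \<phi>) s t \<bullet> unit_normal \<phi> s t;
          g = pd2 (pd2 \<phi>) s t \<bullet> unit_normal \<phi> s t
      in (e * g - f\<^sup>2) / (E * G - F\<^sup>2))"

definition flat_surface_on :: "real set \<Rightarrow> (real \<Rightarrow> real \<Rightarrow> real^3) \<Rightarrow> bool" where
  "flat_surface_on I \<phi> \<longleftrightarrow> (\<forall>s\<in>I. \<forall>t. gauss_curvature \<phi> s t = 0)"


section \<open>Helicoidal surfaces\<close>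

definition helicoidal :: "real \<Rightarrow> (real \<Rightarrow> real) \<Rightarrow> (real \<Rightarrow> real) \<Rightarrow> real \<Rightarrow> real \<Rightarrow> real^3" where
  "helicoidal w x z s t =
     vector [x s * cos (w * t) + z s * sin (w * t), t, - x s * sin (w * t) + z s * cos (w * t)]"

definition surface_trace :: "real set \<Rightarrow> (real \<Rightarrow> real \<Rightarrow> real^3) \<Rightarrow> (real^3) set" where
  "surface_trace I \<phi> = {\<phi> s t | s t. s \<in> I}"

definition round_cylinder :: "real \<Rightarrow> (real^3) set" where
  "round_cylinder r = {p. (p$1)\<^sup>2 + (p$3)\<^sup>2 = r\<^sup>2}"

definition flat_profile :: "real \<Rightarrow> real \<Rightarrow> real \<Rightarrow> real^2" where
  "flat_profile a b s =
     (let v = sqrt (a * s + b); u = 2 * v / a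
      in vector [a / 2 * cos u + v * sin u, v * cos u - a / 2 * sin u])"

end

theory Submission
  imports Defs
begin

text \<open>Why the theorem holds. Write the plane as the complex numbers, let \<open>A\<close> be the curve,
  \<open>U = A'\<close> its unit tangent and \<open>\<kappa>\<close> its curvature, so that \<open>U' = \<i> \<kappa> U\<close>. The isometry that
  takes the curve point to the origin and the tangent to \<open>1\<close> is \<open>v \<mapsto> (v - A) cnj U\<close>. So the
  TreadmillSled is \<open>- M\<close> with \<open>M = A cnj U\<close>, and \<open>M\<close> obeys the single equation
  \<open>M' = 1 - \<i> \<kappa> M\<close> (lemma \<open>M_deriv\<close>), that is,
  \<open>(Re M)' = 1 + \<kappa> Im M\<close> and \<open>(Im M)' = - \<kappa> Re M\<close>.

  The Gauss curvature of the helicoidal surface comes out as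
  \<open>- w\<^sup>2 (1 + \<kappa> Im M) / (1 + w\<^sup>2 (Re M)\<^sup>2)\<^sup>2\<close> (lemma \<open>gauss_curvature_surface\<close>), whose numerator
  is a multiple of \<open>(Re M)'\<close>. Hence the surface is flat if and only if \<open>Re M\<close> is constant, that
  is, the TreadmillSled stays on a vertical line. Flatness also says \<open>\<kappa> Im M = - 1\<close>, so the
  TreadmillSled cannot meet the horizontal axis. On the line through the origin it does not move at
  all, on any other line it stays in one half-line (lemma \<open>flat_cases\<close>).

  A TreadmillSled that rests on the vertical axis means that the curve is an arc of a circle around
  the origin, and the screw motion turns the arc into an open piece of the cylinder over that circle
  (lemma \<open>surface_in_cylinder\<close>). If it moves on another line, then \<open>(Im M)\<^sup>2\<close> is affine in the arc
  length and the angle of the tangent is affine in \<open>Im M\<close>, so \<open>A = M U\<close> is explicit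
  (lemma \<open>half_line_imp_flat_profile\<close>). A rotation about the origin does not change the
  TreadmillSled, and reversing the direction of the curve rotates it by a half turn: every such curve is a
  profile curve up to these two, which is where the rotation matrix and the argument \<open>- \<sigma> s\<close> come
  from.\<close>


section \<open>Vectors in complex notation\<close>

definition plane :: "complex \<Rightarrow> real^2" where
  "plane \<zeta> = vector [Re \<zeta>, Im \<zeta>]"

text \<open>The axis of the screw motion is the second coordinate axis of space; the complex argument
  holds the two coordinates orthogonal to it.\<close>

definition space :: "complex \<Rightarrow> real \<Rightarrow> real^3" where
  "space \<zeta> h = vector [Re \<zeta>, h, Im \<zeta>]"

lemma plane_nth [simp]: "plane \<zeta> $ 1 = Re \<zeta>" "plane \<zeta> $ 2 = Im \<zeta>"
  by (simp_all add: plane_def)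

lemma space_nth [simp]:
  "space \<zeta> h $ 1 = Re \<zeta>" "space \<zeta> h $ 2 = h" "space \<zeta> h $ 3 = Im \<zeta>"
  by (simp_all add: space_def)

lemma norm_plane: "norm (plane \<zeta>) = norm \<zeta>"
  by (simp add: norm_vec_def L2_set_def sum_2 cmod_def)

lemma inner_space: "space \<zeta> h \<bullet> space \<eta> k = Re (\<zeta> * cnj \<eta>) + h * k"
  by (simp add: inner_vec_def sum_3)

lemma cross3_space:
  "cross3 (space \<zeta> 0) (space \<eta> 1) = space (\<i> * \<zeta>) (- Im (cnj \<zeta> * \<eta>))"
  by (simp add: cross3_simps forall_3)

lemma has_vector_derivative_space:
  assumes f: "(f has_vector_derivative f') (at s)" and h: "(h has_vector_derivative h') (at s)"
  shows "((\<lambda>s. space (f s) (h s)) has_vector_derivative space f' h') (at s)"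
proof -
  have eq: "space \<zeta> k = Re \<zeta> *\<^sub>R axis 1 1 + k *\<^sub>R axis 2 1 + Im \<zeta> *\<^sub>R axis 3 1" for \<zeta> k
    by (simp add: vec_eq_iff forall_3 axis_def)
  have "((\<lambda>s. Re (f s)) has_vector_derivative Re f') (at s)"
    "((\<lambda>s. Im (f s)) has_vector_derivative Im f') (at s)"
    using bounded_linear.has_vector_derivative [OF bounded_linear_Re f]
      bounded_linear.has_vector_derivative [OF bounded_linear_Im f] by auto
  with h show ?thesis
    unfolding eq
    by (intro has_vector_derivative_add
        bounded_linear.has_vector_derivative [OF bounded_linear_scaleR_left])
qed

lemma has_vector_derivative_cis:
  assumes "(\<theta> has_real_derivative \<theta>') (at s)"
  shows "((\<lambda>s. cis (\<theta> s)) has_vector_derivative of_real \<theta>' * \<i> * cis (\<theta> s)) (at s)"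
proof -
  have "(\<theta> has_derivative (\<lambda>h. h * \<theta>')) (at s)"
    using assms unfolding has_field_derivative_def
    by (rule has_derivative_eq_rhs) (auto simp: mult.commute)
  from has_derivative_cis [OF this] show ?thesis
    by (simp add: has_vector_derivative_def scaleR_conv_of_real mult_ac)
qed

lemma has_vector_derivative_cnj:
  "(f has_vector_derivative f') F \<Longrightarrow> ((\<lambda>s. cnj (f s)) has_vector_derivative cnj f') F"
  by (rule bounded_linear.has_vector_derivative [OF bounded_linear_cnj])

lemma has_real_derivative_Re:
  "(f has_vector_derivative f') (at s) \<Longrightarrow> ((\<lambda>s. Re (f s)) has_real_derivative Re f') (at s)"
  unfolding has_real_derivative_iff_has_vector_derivative
  by (rule bounded_linear.has_vector_derivative [OF bounded_linear_Re])

lemma has_real_derivative_Im: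
  "(f has_vector_derivative f') (at s) \<Longrightarrow> ((\<lambda>s. Im (f s)) has_real_derivative Im f') (at s)"
  unfolding has_real_derivative_iff_has_vector_derivative
  by (rule bounded_linear.has_vector_derivative [OF bounded_linear_Im])


section \<open>The moving frame\<close>

text \<open>The assumption on \<open>U\<close> is the Frenet equation: \<open>\<i> * U\<close> is the unit normal, and \<open>\<kappa>\<close> the
  signed curvature.\<close>

locale unit_speed_curve =
  fixes I :: "real set" and A U :: "real \<Rightarrow> complex" and \<kappa> :: "real \<Rightarrow> real"
  assumes open_I: "open I" and interval_I: "is_interval I" and nonempty_I: "I \<noteq> {}"
    and A_deriv: "s \<in> I \<Longrightarrow> (A has_vector_derivative U s) (at s)"
    and U_deriv: "s \<in> I \<Longrightarrow> (U has_vector_derivative \<i> * of_real (\<kappa> s) * U s) (at s)"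
    and norm_U: "s \<in> I \<Longrightarrow> norm (U s) = 1"
begin

text \<open>The real and imaginary parts of \<open>M\<close> are the coordinates of the position vector \<open>A\<close> along the
  tangent and the normal. Thus \<open>- M\<close> is the TreadmillSled: the position of the origin, seen from
  the point of contact in the moving frame.\<close>

definition M :: "real \<Rightarrow> complex" where
  "M s = A s * cnj (U s)"

lemma U_cnj: "s \<in> I \<Longrightarrow> U s * cnj (U s) = 1"
  by (metis complex_norm_square norm_U of_real_1 power_one)

lemma A_eq: "s \<in> I \<Longrightarrow> A s = M s * U s"
  using U_cnj [of s] by (simp add: M_def mult_ac)

lemma norm_M: "s \<in> I \<Longrightarrow> norm (M s) = norm (A s)"
  by (simp add: M_def norm_mult norm_U)

lemma M_deriv:
  assumes "s \<in> I"
  shows "(M has_vector_derivative 1 - \<i> * of_real (\<kappa> s) * M s) (at s)"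
proof -
  have "(M has_vector_derivative
      A s * cnj (\<i> * of_real (\<kappa> s) * U s) + U s * cnj (U s)) (at s)"
    unfolding M_def [abs_def]
    by (intro has_vector_derivative_mult has_vector_derivative_cnj A_deriv U_deriv assms)
  then show ?thesis
    using assms by (simp add: U_cnj M_def algebra_simps)
qed

lemma Re_M_deriv: "s \<in> I \<Longrightarrow> ((\<lambda>s. Re (M s)) has_real_derivative 1 + \<kappa> s * Im (M s)) (at s)"
  using has_real_derivative_Re [OF M_deriv] by fastforce

lemma Im_M_deriv: "s \<in> I \<Longrightarrow> ((\<lambda>s. Im (M s)) has_real_derivative - \<kappa> s * Re (M s)) (at s)"
  using has_real_derivative_Im [OF M_deriv] by fastforce

lemma convex_I: "convex I"
  using interval_I by (simp add: is_interval_convex_1)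

lemma constant_on_I:
  assumes "\<And>s. s \<in> I \<Longrightarrow> (f has_vector_derivative 0) (at s)"
  shows "\<exists>c. \<forall>s\<in>I. f s = c"
  using has_vector_derivative_zero_constant [OF convex_I has_vector_derivative_at_within [OF assms]]
  by metis

lemma constant_on_I_real:
  fixes f :: "real \<Rightarrow> real"
  assumes "\<And>s. s \<in> I \<Longrightarrow> (f has_real_derivative 0) (at s)"
  shows "\<exists>c. \<forall>s\<in>I. f s = c"
  using assms by (intro constant_on_I) (simp add: has_real_derivative_iff_has_vector_derivative)

lemma Re_M_constant_iff:
  "(\<exists>c. \<forall>s\<in>I. Re (M s) = c) \<longleftrightarrow> (\<forall>s\<in>I. 1 + \<kappa> s * Im (M s) = 0)"
proof
  assume "\<exists>c. \<forall>s\<in>I. Re (M s) = c"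
  then obtain c where c: "\<And>s. s \<in> I \<Longrightarrow> Re (M s) = c"
    by blast
  show "\<forall>s\<in>I. 1 + \<kappa> s * Im (M s) = 0"
  proof
    fix s assume s: "s \<in> I"
    have "((\<lambda>s. Re (M s)) has_real_derivative 0) (at s)"
      by (rule has_field_derivative_transform_within_open [OF DERIV_const open_I s])
        (simp add: c)
    then show "1 + \<kappa> s * Im (M s) = 0"
      using Re_M_deriv [OF s] DERIV_unique by blast
  qed
next
  assume "\<forall>s\<in>I. 1 + \<kappa> s * Im (M s) = 0"
  then show "\<exists>c. \<forall>s\<in>I. Re (M s) = c"
    using Re_M_deriv by (intro constant_on_I_real) fastforce
qed


section \<open>The Gauss curvature of the helicoidal surface\<close>

abbreviation surface :: "real \<Rightarrow> real \<Rightarrow> real \<Rightarrow> real^3" where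
  "surface w \<equiv> helicoidal w (\<lambda>s. Re (A s)) (\<lambda>s. Im (A s))"

text \<open>The surface sweeps out the curve by a screw motion: at height \<open>t\<close> it is the curve rotated by
  the angle \<open>- w t\<close>.\<close>

lemma surface_eq: "surface w s t = space (A s * cis (- (w * t))) t"
  by (simp add: helicoidal_def space_def algebra_simps)

lemma pd1_surface:
  assumes "s \<in> I"
  shows "pd1 (surface w) s t = space (U s * cis (- (w * t))) 0"
  unfolding pd1_def surface_eq [abs_def]
  by (intro vector_derivative_at has_vector_derivative_space has_vector_derivative_const
      has_vector_derivative_mult_left A_deriv assms)

lemma cis_turn_deriv:
  "((\<lambda>t. \<zeta> * cis (- (w * t))) has_vector_derivative \<zeta> * (- of_real w * \<i>) * cis (- (w * t))) (at t)"
proof -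
  have "((\<lambda>t. - (w * t)) has_real_derivative - w) (at t)"
    by (auto intro!: derivative_eq_intros)
  from has_vector_derivative_mult_right [OF has_vector_derivative_cis [OF this], of \<zeta>]
  show ?thesis
    by (simp add: mult_ac)
qed

lemma pd2_surface:
  "pd2 (surface w) s t = space (A s * (- of_real w * \<i>) * cis (- (w * t))) 1"
  unfolding pd2_def surface_eq [abs_def]
  by (intro vector_derivative_at has_vector_derivative_space has_vector_derivative_id
      cis_turn_deriv)

text \<open>The formula for the first derivative is available only on the domain of the curve; as that is
  open, it may be differentiated there.\<close>

lemma pd11_surface:
  assumes "s \<in> I"
  shows "pd1 (pd1 (surface w)) s t = space (\<i> * of_real (\<kappa> s) * U s * cis (- (w * t))) 0"
proof -
  have "((\<lambda>s. pd1 (surface w) s t) has_vector_derivative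
      space (\<i> * of_real (\<kappa> s) * U s * cis (- (w * t))) 0) (at s)"
  proof (rule has_vector_derivative_transform_within_open [OF _ open_I assms])
    show "((\<lambda>s. space (U s * cis (- (w * t))) 0) has_vector_derivative
        space (\<i> * of_real (\<kappa> s) * U s * cis (- (w * t))) 0) (at s)"
      by (intro has_vector_derivative_space has_vector_derivative_const
          has_vector_derivative_mult_left U_deriv assms)
  qed (simp add: pd1_surface)
  then show ?thesis
    unfolding pd1_def [of "pd1 (surface w)"] by (rule vector_derivative_at)
qed

lemma pd21_surface:
  assumes "s \<in> I"
  shows "pd2 (pd1 (surface w)) s t = space (U s * (- of_real w * \<i>) * cis (- (w * t))) 0"
  unfolding pd2_def pd1_surface [OF assms]
  by (intro vector_derivative_at has_vector_derivative_space has_vector_derivative_const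
      cis_turn_deriv)

lemma pd22_surface:
  "pd2 (pd2 (surface w)) s t =
     space (A s * (- of_real w * \<i>) * (- of_real w * \<i>) * cis (- (w * t))) 0"
  unfolding pd2_def [of "pd2 (surface w)"] pd2_surface
  by (intro vector_derivative_at has_vector_derivative_space has_vector_derivative_const
      cis_turn_deriv)

text \<open>Rotating by \<open>c = cis (- w t)\<close> changes no inner product, so everything is expressed through
  \<open>u = U c\<close> and \<open>a = A c\<close>, whose products are \<open>u cnj u = 1\<close>, \<open>a cnj u = M\<close> and
  \<open>a cnj a = \<bar>M\<bar>\<^sup>2\<close>. The normal \<open>N\<close> is not of unit length; its square length is \<open>D\<close>, which is
  also \<open>E G - F\<^sup>2\<close>. The second fundamental form, scaled by \<open>sqrt D\<close>, is \<open>e = \<kappa>\<close>, \<open>f = - w\<close>,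
  \<open>g = - w\<^sup>2 Im M\<close>, and the determinant contains the factor \<open>1 + \<kappa> Im M = (Re M)'\<close>.\<close>

lemma gauss_curvature_surface:
  assumes s: "s \<in> I"
  shows "gauss_curvature (surface w) s t =
           - w\<^sup>2 * (1 + \<kappa> s * Im (M s)) / (1 + w\<^sup>2 * (Re (M s))\<^sup>2)\<^sup>2"
proof -
  define c where "c = cis (- (w * t))"
  have cc: "c * cnj c = 1"
    by (simp add: c_def cis_cnj cis_mult)
  have UU: "U s * c * cnj (U s * c) = 1" and MM: "A s * c * cnj (U s * c) = M s"
    using cc U_cnj [OF s] by (simp_all add: M_def mult_ac)
  have UM: "U s * c * cnj (A s * c) = cnj (M s)"
    using arg_cong [OF MM, of cnj] by (simp add: mult_ac)
  have AA: "A s * c * cnj (A s * c) = of_real ((Re (M s))\<^sup>2 + (Im (M s))\<^sup>2)"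
  proof -
    have "A s * c * cnj (A s * c) = A s * cnj (A s) * (c * cnj c)"
      by (simp add: mult_ac)
    also have "\<dots> = of_real ((norm (M s))\<^sup>2)"
      unfolding cc by (simp only: complex_norm_square norm_M [OF s] mult_1_right)
    finally show ?thesis
      by (simp only: cmod_power2)
  qed
  define D where "D = 1 + w\<^sup>2 * (Re (M s))\<^sup>2"
  have D: "D > 0"
    unfolding D_def by (simp add: add_pos_nonneg)
  define u a where "u = U s * c" and "a = A s * c"
  note ua = UU [folded u_def a_def] MM [folded u_def a_def] UM [folded u_def a_def]
    AA [folded u_def a_def]
  have p1: "pd1 (surface w) s t = space u 0"
    by (simp add: pd1_surface [OF s] u_def c_def)
  have p2: "pd2 (surface w) s t = space (- of_real w * \<i> * a) 1"
    by (simp add: pd2_surface a_def c_def mult_ac)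
  have p11: "pd1 (pd1 (surface w)) s t = space (\<i> * of_real (\<kappa> s) * u) 0"
    by (simp add: pd11_surface [OF s] u_def c_def mult_ac)
  have p21: "pd2 (pd1 (surface w)) s t = space (- of_real w * \<i> * u) 0"
    by (simp add: pd21_surface [OF s] u_def c_def mult_ac)
  have p22: "pd2 (pd2 (surface w)) s t = space (- of_real (w\<^sup>2) * a) 0"
    by (simp add: pd22_surface a_def c_def mult_ac power2_eq_square)
  define N where "N = space (\<i> * u) (w * Re (M s))"
  have N: "cross3 (pd1 (surface w) s t) (pd2 (surface w) s t) = N"
  proof -
    have "- Im (cnj u * (- of_real w * \<i> * a)) = w * Re (a * cnj u)"
      by (simp add: algebra_simps)
    then show ?thesis
      unfolding p1 p2 cross3_space N_def ua by (rule arg_cong)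
  qed
  have inner_u: "space (\<zeta> * u) 0 \<bullet> N = Im \<zeta>" for \<zeta>
  proof -
    have "space (\<zeta> * u) 0 \<bullet> N = Re (- \<i> * \<zeta> * (u * cnj u))"
      by (simp add: N_def inner_space mult_ac)
    then show ?thesis
      unfolding ua by simp
  qed
  have inner_a: "space (\<zeta> * a) 0 \<bullet> N = Im (\<zeta> * M s)" for \<zeta>
  proof -
    have "space (\<zeta> * a) 0 \<bullet> N = Re (- \<i> * \<zeta> * (a * cnj u))"
      by (simp add: N_def inner_space algebra_simps)
    then show ?thesis
      unfolding ua by simp
  qed
  have NN: "N \<bullet> N = D"
  proof -
    have "N \<bullet> N = Re (u * cnj u) + (w * Re (M s))\<^sup>2"
      by (simp add: N_def inner_space power2_eq_square)
    then show ?thesis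
      unfolding ua by (simp add: D_def power_mult_distrib)
  qed
  have E: "space u 0 \<bullet> space u 0 = 1"
    by (simp add: inner_space ua(1) del: times_complex.simps)
  have F: "space u 0 \<bullet> space (- of_real w * \<i> * a) 1 = w * Im (M s)"
  proof -
    have "space u 0 \<bullet> space (- of_real w * \<i> * a) 1 = Re (of_real w * \<i> * (u * cnj a))"
      by (simp add: inner_space algebra_simps)
    then show ?thesis
      unfolding ua by simp
  qed
  have G: "space (- of_real w * \<i> * a) 1 \<bullet> space (- of_real w * \<i> * a) 1 =
      1 + w\<^sup>2 * ((Re (M s))\<^sup>2 + (Im (M s))\<^sup>2)"
  proof -
    have "space (- of_real w * \<i> * a) 1 \<bullet> space (- of_real w * \<i> * a) 1 =
        Re (of_real (w\<^sup>2) * (a * cnj a)) + 1"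
      by (simp add: inner_space algebra_simps power2_eq_square)
    then show ?thesis
      unfolding ua by simp
  qed
  have n: "unit_normal (surface w) s t = N /\<^sub>R sqrt D"
    by (simp add: unit_normal_def N sgn_div_norm norm_eq_sqrt_inner NN)
  have e: "pd1 (pd1 (surface w)) s t \<bullet> unit_normal (surface w) s t = \<kappa> s / sqrt D"
    unfolding p11 n using inner_u [of "\<i> * of_real (\<kappa> s)"] by (simp add: divide_inverse mult.commute)
  have f: "pd2 (pd1 (surface w)) s t \<bullet> unit_normal (surface w) s t = - w / sqrt D"
    unfolding p21 n using inner_u [of "- of_real w * \<i>"] by (simp add: divide_inverse mult.commute)
  have g: "pd2 (pd2 (surface w)) s t \<bullet> unit_normal (surface w) s t =
      - w\<^sup>2 * Im (M s) / sqrt D"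
    unfolding p22 n using inner_a [of "- of_real (w\<^sup>2)"] by (simp add: divide_inverse mult.commute)
  have "gauss_curvature (surface w) s t =
      (\<kappa> s / sqrt D * (- w\<^sup>2 * Im (M s) / sqrt D) - (- w / sqrt D)\<^sup>2) /
      (1 * (1 + w\<^sup>2 * ((Re (M s))\<^sup>2 + (Im (M s))\<^sup>2)) - (w * Im (M s))\<^sup>2)"
    unfolding gauss_curvature_def Let_def e f g p1 p2 E F G ..
  also have "\<kappa> s / sqrt D * (- w\<^sup>2 * Im (M s) / sqrt D) - (- w / sqrt D)\<^sup>2 =
      - w\<^sup>2 * (1 + \<kappa> s * Im (M s)) / D"
    using D by (simp add: field_simps power2_eq_square)
  also have "1 * (1 + w\<^sup>2 * ((Re (M s))\<^sup>2 + (Im (M s))\<^sup>2)) - (w * Im (M s))\<^sup>2 = D"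
    by (simp add: D_def algebra_simps power2_eq_square)
  finally show ?thesis
    by (simp add: D_def power2_eq_square)
qed

lemma flat_iff:
  assumes "w \<noteq> 0"
  shows "flat_surface_on I (surface w) \<longleftrightarrow> (\<exists>c. \<forall>s\<in>I. Re (M s) = c)"
proof -
  have "1 + w\<^sup>2 * (Re (M s))\<^sup>2 \<noteq> 0" for s
    by (smt (verit) mult_nonneg_nonneg zero_le_power2)
  then show ?thesis
    using assms by (simp add: flat_surface_on_def gauss_curvature_surface Re_M_constant_iff)
qed


section \<open>The two kinds of flat surfaces\<close>

text \<open>When \<open>Re M\<close> is a constant \<open>c\<close>, the frame equations force \<open>\<kappa> Im M = - 1\<close>, so
  \<open>Im M\<close> never vanishes. If \<open>c = 0\<close>, then \<open>(Im M)' = - \<kappa> c = 0\<close> and \<open>M\<close> is a point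
  of the imaginary axis, not the origin. If \<open>c \<noteq> 0\<close>, then \<open>Im M\<close> keeps its sign because the
  domain is connected, which puts \<open>M\<close> on one half-line.\<close>

lemma flat_cases:
  "(\<exists>c. \<forall>s\<in>I. Re (M s) = c) \<longleftrightarrow>
     (\<exists>k. k \<noteq> 0 \<and> (\<forall>s\<in>I. M s = \<i> * of_real k)) \<or>
     (\<exists>c \<sigma>. c \<noteq> 0 \<and> \<sigma> \<in> {1, -1} \<and> (\<forall>s\<in>I. \<exists>r\<ge>0. M s = - Complex c (\<sigma> * r)))"
    (is "?flat \<longleftrightarrow> ?i \<or> ?ii")
proof
  assume ?flat
  then obtain c where c: "\<And>s. s \<in> I \<Longrightarrow> Re (M s) = c"
    by blast
  have \<kappa>: "1 + \<kappa> s * Im (M s) = 0" if "s \<in> I" for s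
    using \<open>?flat\<close> that unfolding Re_M_constant_iff by blast
  then have nz: "Im (M s) \<noteq> 0" if "s \<in> I" for s
    using that by force
  show "?i \<or> ?ii"
  proof (cases "c = 0")
    case True
    have "((\<lambda>s. Im (M s)) has_real_derivative 0) (at s)" if "s \<in> I" for s
      using Im_M_deriv [OF that] c [OF that] True by simp
    from constant_on_I_real [OF this]
    obtain k where k: "\<And>s. s \<in> I \<Longrightarrow> Im (M s) = k"
      by blast
    have "k \<noteq> 0"
      using nz k nonempty_I by blast
    then have ?i
      using c k True by (auto simp: complex_eq_iff)
    then show ?thesis ..
  next
    case False
    have "continuous_on I (\<lambda>s. Im (M s))"
      using Im_M_deriv by (meson DERIV_isCont continuous_at_imp_continuous_on)
    then have "connected ((\<lambda>s. Im (M s)) ` I)"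
      by (intro connected_continuous_image convex_connected convex_I)
    then have "is_interval ((\<lambda>s. Im (M s)) ` I)"
      by (simp add: is_interval_connected_1)
    moreover have "0 \<notin> (\<lambda>s. Im (M s)) ` I"
      using nz by auto
    ultimately have no_change: "\<not> (Im (M s) \<le> 0 \<and> 0 \<le> Im (M s'))" if "s \<in> I" "s' \<in> I" for s s'
      using that unfolding is_interval_1 by blast
    have "(\<forall>s\<in>I. 0 < Im (M s)) \<or> (\<forall>s\<in>I. Im (M s) < 0)"
      using no_change by (meson linorder_not_le order_less_imp_le)
    then consider "\<forall>s\<in>I. 0 < Im (M s)" | "\<forall>s\<in>I. Im (M s) < 0"
      by blast
    then have "\<exists>\<sigma>\<in>{1, -1}. \<forall>s\<in>I. 0 \<le> - \<sigma> * Im (M s)"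
      by cases force+
    then obtain \<sigma> :: real where \<sigma>: "\<sigma> \<in> {1, -1}" and "\<forall>s\<in>I. 0 \<le> - \<sigma> * Im (M s)"
      by blast
    moreover have "M s = - Complex (- c) (\<sigma> * (- \<sigma> * Im (M s)))" if "s \<in> I" for s
      using c [OF that] \<sigma> by (auto simp: complex_eq_iff)
    ultimately have "\<forall>s\<in>I. \<exists>r\<ge>0. M s = - Complex (- c) (\<sigma> * r)"
      by blast
    with \<sigma> False have ?ii
      by (intro exI [of _ "- c"] exI [of _ \<sigma>]) simp
    then show ?thesis ..
  qed
next
  assume "?i \<or> ?ii"
  then show ?flat
  proof
    assume ?i
    then show ?flat
      by (intro exI [of _ 0]) auto
  next
    assume ?ii
    then obtain c \<sigma> where "\<forall>s\<in>I. \<exists>r\<ge>0. M s = - Complex c (\<sigma> * r)"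
      by blast
    then show ?flat
      by (intro exI [of _ "- c"]) auto
  qed
qed

text \<open>Here \<open>A = \<i> k U\<close>, hence \<open>A' = - (\<i> / k) A\<close>: the curve runs at constant angular speed on
  the circle of radius \<open>\<bar>k\<bar>\<close>, as \<open>A s = exp (L - \<i> s / k)\<close> for some \<open>L\<close>. It need not run
  all the way round, so the content is that its image is open in the circle. An arc is the intersection of
  the circle with the exponential of an open strip, and the exponential, being a covering, is an
  open map.\<close>

lemma curve_in_circle:
  assumes k: "k \<noteq> 0" and M: "\<And>s. s \<in> I \<Longrightarrow> M s = \<i> * of_real k"
  shows "openin (top_of_set (sphere 0 \<bar>k\<bar>)) (A ` I)" "I = UNIV \<Longrightarrow> A ` I = sphere 0 \<bar>k\<bar>"
proof -
  have "((\<lambda>s. A s * cis (s / k)) has_vector_derivative 0) (at s)" if s: "s \<in> I" for s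
  proof -
    have "((\<lambda>s. s / k) has_real_derivative 1 / k) (at s)"
      using DERIV_cdivide [OF DERIV_ident] .
    from has_vector_derivative_mult [OF A_deriv [OF s] has_vector_derivative_cis [OF this]]
    show ?thesis
      using k by (simp add: A_eq [OF s] M [OF s] mult_ac)
  qed
  from constant_on_I [OF this]
  obtain \<zeta>\<^sub>0 where \<zeta>\<^sub>0: "\<And>s. s \<in> I \<Longrightarrow> A s * cis (s / k) = \<zeta>\<^sub>0"
    by blast
  obtain s\<^sub>0 where s0: "s\<^sub>0 \<in> I"
    using nonempty_I by blast
  have norm0: "norm \<zeta>\<^sub>0 = \<bar>k\<bar>"
    using \<zeta>\<^sub>0 [OF s0] norm_M [OF s0] M [OF s0] by (auto simp: norm_mult)
  with k have "\<zeta>\<^sub>0 \<noteq> 0"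
    by force
  then obtain L where L: "exp L = \<zeta>\<^sub>0"
    using exp_Ln by blast
  have exp_L: "exp (L - \<i> * of_real (s / k)) = A s" if "s \<in> I" for s
    using \<zeta>\<^sub>0 [OF that, symmetric] by (simp add: exp_diff L cis_conv_exp)
  define T where "T = {\<zeta>. k * (Im L - Im \<zeta>) \<in> I}"
  have eq: "A ` I = sphere 0 \<bar>k\<bar> \<inter> exp ` T"
  proof
    show "A ` I \<subseteq> sphere 0 \<bar>k\<bar> \<inter> exp ` T"
    proof
      fix \<zeta> assume "\<zeta> \<in> A ` I"
      then obtain s where s: "s \<in> I" and \<zeta>: "\<zeta> = A s"
        by blast
      have "L - \<i> * of_real (s / k) \<in> T"
        using k s by (simp add: T_def)
      then have "\<zeta> \<in> exp ` T"
        using exp_L [OF s] \<zeta> by (metis image_eqI)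
      moreover have "norm \<zeta> = \<bar>k\<bar>"
        using norm_M [OF s] M [OF s] \<zeta> by (simp add: norm_mult)
      ultimately show "\<zeta> \<in> sphere 0 \<bar>k\<bar> \<inter> exp ` T"
        by simp
    qed
  next
    show "sphere 0 \<bar>k\<bar> \<inter> exp ` T \<subseteq> A ` I"
    proof
      fix \<xi> assume "\<xi> \<in> sphere 0 \<bar>k\<bar> \<inter> exp ` T"
      then obtain \<zeta> where \<xi>: "\<xi> = exp \<zeta>" and "norm (exp \<zeta>) = \<bar>k\<bar>" and T: "\<zeta> \<in> T"
        by auto
      then have "exp (Re \<zeta>) = exp (Re L)"
        using norm0 L by (metis norm_exp_eq_Re)
      then have "\<zeta> = L - \<i> * of_real (k * (Im L - Im \<zeta>) / k)"
        using k by (simp add: complex_eq_iff)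
      then show "\<xi> \<in> A ` I"
        using exp_L T unfolding \<xi> T_def by (metis imageI mem_Collect_eq)
    qed
  qed
  have "open T"
    unfolding T_def
    using continuous_open_vimage [OF open_I, of "\<lambda>\<zeta>. k * (Im L - Im \<zeta>)"]
    by (simp add: vimage_def continuous_intros)
  then have "open (exp ` T)"
    using covering_space_open_map [OF covering_space_exp_punctured_plane, of T]
    by (simp add: openin_open_eq open_Compl)
  then show "openin (top_of_set (sphere 0 \<bar>k\<bar>)) (A ` I)"
    unfolding eq by (auto simp: openin_open)
  assume "I = UNIV"
  then have "exp ` T = - {0}"
    by (auto simp: T_def) (metis exp_Ln rangeI)
  then show "A ` I = sphere 0 \<bar>k\<bar>"
    unfolding eq using k by auto
qed

lemma surface_trace_eq:
  "surface_trace I (surface w) = {p. Complex (p$1) (p$3) * cis (w * p$2) \<in> A ` I}"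
proof -
  have "p = space (\<zeta> * cis (- (w * t))) t \<longleftrightarrow>
      t = p$2 \<and> Complex (p$1) (p$3) * cis (w * p$2) = \<zeta>" for p \<zeta> t
  proof -
    have "p = space (\<zeta> * cis (- (w * t))) t \<longleftrightarrow>
        t = p$2 \<and> Complex (p$1) (p$3) = \<zeta> * cis (- (w * p$2))"
      by (auto simp: vec_eq_iff forall_3 complex_eq_iff)
    also have "\<dots> \<longleftrightarrow> t = p$2 \<and> Complex (p$1) (p$3) * cis (w * p$2) = \<zeta>"
    proof -
      have "cis (- (w * p$2)) * cis (w * p$2) = 1"
        by (simp add: cis_mult)
      then have "a = \<zeta> * cis (- (w * p$2)) \<longleftrightarrow> a * cis (w * p$2) = \<zeta>" for a
        by (metis cis_neq_zero mult.assoc mult.right_neutral mult_cancel_right)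
      then show ?thesis
        by simp
    qed
    finally show ?thesis .
  qed
  then show ?thesis
    unfolding surface_trace_def surface_eq by auto
qed

text \<open>Unscrewing a point of space by the angle that belongs to its height is continuous, and it
  pulls the circle back to the cylinder and the curve back to the surface.\<close>

lemma surface_in_cylinder:
  assumes k: "k \<noteq> 0" and M: "\<And>s. s \<in> I \<Longrightarrow> M s = \<i> * of_real k"
  shows "openin (top_of_set (round_cylinder \<bar>k\<bar>)) (surface_trace I (surface w))"
    and "I = UNIV \<Longrightarrow> surface_trace I (surface w) = round_cylinder \<bar>k\<bar>"
proof -
  define turn :: "real^3 \<Rightarrow> complex" where
    "turn = (\<lambda>p. Complex (p$1) (p$3) * cis (w * p$2))"
  have cyl: "round_cylinder \<bar>k\<bar> = turn -` sphere 0 \<bar>k\<bar>"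
  proof -
    have "(norm (turn p))\<^sup>2 = (p$1)\<^sup>2 + (p$3)\<^sup>2" for p
      by (simp add: turn_def norm_mult cmod_power2)
    then show ?thesis
      by (auto simp: round_cylinder_def) (metis abs_ge_zero norm_ge_zero power2_abs power2_eq_iff_nonneg)+
  qed
  have tr: "surface_trace I (surface w) = turn -` (A ` I)"
    by (auto simp: surface_trace_eq turn_def)
  have "continuous_on (round_cylinder \<bar>k\<bar>) turn"
    unfolding turn_def Complex_eq by (intro continuous_intros)
  then have "openin (top_of_set (round_cylinder \<bar>k\<bar>)) (round_cylinder \<bar>k\<bar> \<inter> turn -` (A ` I))"
    by (rule continuous_openin_preimage [OF _ _ curve_in_circle(1) [OF k M]]) (auto simp: cyl)
  moreover have "A ` I \<subseteq> sphere 0 \<bar>k\<bar>"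
    using curve_in_circle(1) [OF k M] openin_imp_subset by blast
  ultimately show "openin (top_of_set (round_cylinder \<bar>k\<bar>)) (surface_trace I (surface w))"
    unfolding tr cyl by (metis vimage_mono inf.absorb2)
  assume "I = UNIV"
  then show "surface_trace I (surface w) = round_cylinder \<bar>k\<bar>"
    unfolding tr cyl using curve_in_circle(2) [OF k M] by simp
qed

text \<open>For constant \<open>Re M = - c\<close> the motion is integrated in two steps. Flatness says
  \<open>\<kappa> Im M = - 1\<close>, so \<open>(Im M)\<^sup>2\<close> has derivative \<open>- 2 \<kappa> Re M Im M = - 2 c\<close> and is affine in
  \<open>s\<close>; this is the radicand of the profile. The angle \<open>u = - Im M / c\<close> has derivative \<open>- \<kappa>\<close>,
  the rate at which the tangent turns backwards, so \<open>U cis u\<close> is a constant \<open>\<eta>\<close>. What remains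
  is \<open>A = M U = \<eta> M cis (- u)\<close>, where \<open>M = - \<sigma> (a / 2 + \<i> v)\<close> for \<open>a = 2 c \<sigma>\<close>
  and \<open>v = \<bar>Im M\<bar>\<close>, and \<open>(a / 2 + \<i> v) cis (- u)\<close> is the profile curve.\<close>

lemma half_line_imp_flat_profile:
  assumes c: "c \<noteq> 0" and \<sigma>: "\<sigma> \<in> {1, -1}"
    and M: "\<And>s. s \<in> I \<Longrightarrow> \<exists>r\<ge>0. M s = - Complex c (\<sigma> * r)"
  shows "\<exists>a b \<eta>. a \<noteq> 0 \<and> norm \<eta> = 1 \<and>
           (\<forall>s\<in>I. a * (- \<sigma> * s) + b > 0 \<and>
             A s = \<eta> * Complex (flat_profile a b (- \<sigma> * s) $ 1)
                               (flat_profile a b (- \<sigma> * s) $ 2))"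
proof -
  have Re: "Re (M s) = - c" if "s \<in> I" for s
    using M [OF that] by auto
  then have \<kappa>: "\<kappa> s * Im (M s) = - 1" if "s \<in> I" for s
    using Re_M_constant_iff that by (metis add_eq_0_iff)
  have \<sigma>\<sigma>: "\<sigma> * \<sigma> = 1"
    using \<sigma> by auto
  have "((\<lambda>s. (Im (M s))\<^sup>2 + 2 * c * s) has_real_derivative 0) (at s)" if s: "s \<in> I" for s
  proof -
    have "((\<lambda>s. (Im (M s))\<^sup>2 + 2 * c * s) has_real_derivative
        2 * Im (M s) * (- \<kappa> s * Re (M s)) + 2 * c) (at s)"
      by (rule derivative_eq_intros Im_M_deriv s refl)+ simp
    moreover have "2 * Im (M s) * (- \<kappa> s * Re (M s)) + 2 * c = 0"
      using \<kappa> [OF s] Re [OF s] by algebra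
    ultimately show ?thesis
      by simp
  qed
  from constant_on_I_real [OF this]
  obtain b where b: "\<And>s. s \<in> I \<Longrightarrow> (Im (M s))\<^sup>2 + 2 * c * s = b"
    by blast
  have "((\<lambda>s. U s * cis (- Im (M s) / c)) has_vector_derivative 0) (at s)" if s: "s \<in> I" for s
  proof -
    have "((\<lambda>s. - Im (M s) / c) has_real_derivative - \<kappa> s) (at s)"
      using DERIV_cdivide [OF DERIV_minus [OF Im_M_deriv [OF s]], of c] c by (simp add: Re [OF s])
    from has_vector_derivative_mult [OF U_deriv [OF s] has_vector_derivative_cis [OF this]]
    show ?thesis
      by (simp add: mult_ac)
  qed
  from constant_on_I [OF this]
  obtain \<eta> where \<eta>: "\<And>s. s \<in> I \<Longrightarrow> U s * cis (- Im (M s) / c) = \<eta>"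
    by blast
  have "norm \<eta> = 1"
    using \<eta> norm_U nonempty_I by (metis ex_in_conv mult.right_neutral norm_cis norm_mult)
  moreover define a where "a = 2 * c * \<sigma>"
  have a: "a \<noteq> 0"
    using c \<sigma> by (auto simp: a_def)
  have "a * (- \<sigma> * s) + b > 0 \<and>
      A s = - of_real \<sigma> * \<eta> * Complex (flat_profile a b (- \<sigma> * s) $ 1)
                                     (flat_profile a b (- \<sigma> * s) $ 2)" if s: "s \<in> I" for s
  proof
    define v where "v = - \<sigma> * Im (M s)"
    have v: "v \<ge> 0"
      using M [OF s] \<sigma> by (auto simp: v_def)
    have rad: "a * (- \<sigma> * s) + b = v\<^sup>2"
      unfolding a_def v_def b [OF s, symmetric] using \<sigma>\<sigma> by algebra
    have "v \<noteq> 0"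
      using \<kappa> [OF s] \<sigma> by (auto simp: v_def)
    then show "a * (- \<sigma> * s) + b > 0"
      unfolding rad by simp
    define u where "u = 2 * v / a"
    have u: "u = - Im (M s) / c"
      using c \<sigma> by (auto simp: u_def v_def a_def)
    have "flat_profile a b (- \<sigma> * s) =
        vector [a / 2 * cos u + v * sin u, v * cos u - a / 2 * sin u]"
      unfolding flat_profile_def Let_def rad u_def using v by simp
    then have fp: "Complex (flat_profile a b (- \<sigma> * s) $ 1) (flat_profile a b (- \<sigma> * s) $ 2) =
        Complex (a / 2) v * cis (- u)"
      by (simp add: complex_eq_iff)
    have "M s = - of_real \<sigma> * Complex (a / 2) v"
      using Re [OF s] \<sigma> by (auto simp: complex_eq_iff a_def v_def)
    moreover have "U s = \<eta> * cis (- u)"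
      unfolding \<eta> [OF s, symmetric] u [symmetric] by (simp add: mult.assoc cis_mult)
    ultimately show "A s = - of_real \<sigma> * \<eta> * Complex (flat_profile a b (- \<sigma> * s) $ 1)
        (flat_profile a b (- \<sigma> * s) $ 2)"
      unfolding fp A_eq [OF s] by simp
  qed
  moreover have "norm (- of_real \<sigma> * \<eta>) = 1"
    using \<open>norm \<eta> = 1\<close> \<sigma> by (auto simp: norm_mult)
  ultimately show ?thesis
    using a by (intro exI [of _ a] exI [of _ b] exI [of _ "- of_real \<sigma> * \<eta>"]) simp
qed

end


section \<open>From the plane to complex numbers and back\<close>

lemma rotation_of_unit_complex:
  assumes "norm \<eta> = 1"
  shows "\<exists>Q. rotation_matrix Q \<and> (\<forall>v. Q *v v = plane (\<eta> * Complex (v$1) (v$2)))"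
proof -
  define Q :: "real^2^2" where "Q = vector [vector [Re \<eta>, - Im \<eta>], vector [Im \<eta>, Re \<eta>]]"
  have "Re \<eta> * Re \<eta> + Im \<eta> * Im \<eta> = 1"
    using assms cmod_power2 [of \<eta>] by (simp add: power2_eq_square)
  then have "rotation_matrix Q"
    by (simp add: rotation_matrix_def orthogonal_matrix Q_def det_2 vec_eq_iff forall_2
        matrix_matrix_mult_def transpose_def mat_def sum_2 algebra_simps)
  moreover have "Q *v v = plane (\<eta> * Complex (v$1) (v$2))" for v
    by (simp add: Q_def vec_eq_iff forall_2 matrix_vector_mult_def sum_2)
  ultimately show ?thesis
    by blast
qed

lemma bounded_linear_Complex: "bounded_linear (\<lambda>v :: real^2. Complex (v$1) (v$2))"
  unfolding Complex_eq
  by (intro bounded_linear_intros bounded_linear_compose [OF bounded_linear_of_real]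
      bounded_linear_vec_nth)

text \<open>Differentiating \<open>U cnj U = 1\<close> shows that \<open>U' cnj U\<close> is purely imaginary. Its imaginary part
  is the curvature.\<close>

lemma unit_speed_curve_of_arc_length_curve:
  assumes I: "open I" "is_interval I" "I \<noteq> {}"
    and arc: "arc_length_curve_on I (\<lambda>s. plane (A s))"
  obtains U \<kappa> where "unit_speed_curve I A U \<kappa>"
    and "\<And>s. s \<in> I \<Longrightarrow> treadmill_sled (\<lambda>s. plane (A s)) s = plane (- (A s * cnj (U s)))"
proof -
  obtain \<alpha>' \<alpha>'' where d1: "\<And>s. s \<in> I \<Longrightarrow> ((\<lambda>s. plane (A s)) has_vector_derivative \<alpha>' s) (at s)"
    and d2: "\<And>s. s \<in> I \<Longrightarrow> (\<alpha>' has_vector_derivative \<alpha>'' s) (at s)"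
    using arc unfolding arc_length_curve_on_def C2_curve_on_def by blast
  define U where "U s = Complex (\<alpha>' s $ 1) (\<alpha>' s $ 2)" for s
  define dU where "dU s = Complex (\<alpha>'' s $ 1) (\<alpha>'' s $ 2)" for s
  have U: "\<alpha>' s = plane (U s)" for s
    by (simp add: U_def vec_eq_iff forall_2)
  note Complex_deriv = bounded_linear.has_vector_derivative [OF bounded_linear_Complex]
  have dA: "(A has_vector_derivative U s) (at s)" if "s \<in> I" for s
    using Complex_deriv [OF d1 [OF that]] by (simp add: U_def)
  have ddA: "(U has_vector_derivative dU s) (at s)" if "s \<in> I" for s
    using Complex_deriv [OF d2 [OF that]] by (simp add: U_def [abs_def] dU_def)
  have vd: "vector_derivative (\<lambda>s. plane (A s)) (at s) = plane (U s)" if "s \<in> I" for s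
    using vector_derivative_at [OF d1 [OF that]] by (simp add: U)
  have norm: "norm (U s) = 1" if "s \<in> I" for s
    using arc that by (simp add: arc_length_curve_on_def vd flip: norm_plane)
  then have U1: "U s * cnj (U s) = 1" if "s \<in> I" for s
    using that by (metis complex_norm_square of_real_1 power_one)
  define \<kappa> where "\<kappa> s = Im (dU s * cnj (U s))" for s
  have frenet: "dU s = \<i> * of_real (\<kappa> s) * U s" if s: "s \<in> I" for s
  proof -
    have "((\<lambda>s. U s * cnj (U s)) has_vector_derivative U s * cnj (dU s) + dU s * cnj (U s)) (at s)"
      by (intro has_vector_derivative_mult has_vector_derivative_cnj ddA s)
    moreover have "((\<lambda>s. U s * cnj (U s)) has_vector_derivative 0) (at s)"
      by (rule has_vector_derivative_transform_within_open [OF has_vector_derivative_const I(1) s])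
        (simp add: U1)
    ultimately have "U s * cnj (dU s) + dU s * cnj (U s) = 0"
      by (rule vector_derivative_unique_at)
    then have "2 * Re (dU s * cnj (U s)) = 0"
      by (simp add: complex_eq_iff algebra_simps)
    then have "dU s * cnj (U s) = \<i> * of_real (\<kappa> s)"
      by (auto simp: complex_eq_iff \<kappa>_def)
    then show ?thesis
      using U1 [OF s] by (metis mult.assoc mult.commute mult.right_neutral)
  qed
  have "unit_speed_curve I A U \<kappa>"
    using I dA ddA norm frenet by unfold_locales auto
  moreover have "treadmill_sled (\<lambda>s. plane (A s)) s = plane (- (A s * cnj (U s)))" if "s \<in> I" for s
    using treadmill_sled_eq [OF vd [OF that]] norm [OF that]
    by (simp add: norm_plane vec_eq_iff forall_2 inner_vec_def sum_2 algebra_simps)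
  ultimately show thesis
    using that by blast
qed

theorem theorem1p5:
  fixes w :: real and I :: "real set" and x z :: "real \<Rightarrow> real" and \<alpha> :: "real \<Rightarrow> real^2"
  assumes w: "w > 0"
    and I: "open I" "is_interval I" "I \<noteq> {}"
    and \<alpha>: "\<alpha> = (\<lambda>s. vector [x s, z s])"
    and arc: "arc_length_curve_on I \<alpha>"
  shows "(flat_surface_on I (helicoidal w x z) \<longleftrightarrow>
            (\<exists>p. treadmill_sled \<alpha> ` I = {p} \<and> p $ 1 = 0 \<and> p \<noteq> 0) \<or>
            (\<exists>c \<sigma>. c \<noteq> 0 \<and> \<sigma> \<in> {1, -1} \<and> treadmill_sled \<alpha> ` I \<subseteq> vertical_half_line c \<sigma>))
       \<and> ((\<exists>p. treadmill_sled \<alpha> ` I = {p} \<and> p $ 1 = 0 \<and> p \<noteq> 0) \<longrightarrow>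
            (\<exists>r>0. openin (top_of_set (round_cylinder r)) (surface_trace I (helicoidal w x z)) \<and>
                   (I = UNIV \<longrightarrow> surface_trace I (helicoidal w x z) = round_cylinder r)))
       \<and> (\<forall>c \<sigma>. c \<noteq> 0 \<and> \<sigma> \<in> {1, -1} \<and> treadmill_sled \<alpha> ` I \<subseteq> vertical_half_line c \<sigma> \<longrightarrow>
            (\<exists>a b Q. a \<noteq> 0 \<and> rotation_matrix Q \<and>
               (\<forall>s\<in>I. a * (- \<sigma> * s) + b > 0 \<and> \<alpha> s = Q *v flat_profile a b (- \<sigma> * s))))"
proof -
  define A where "A s = Complex (x s) (z s)" for s
  have \<alpha>A: "\<alpha> = (\<lambda>s. plane (A s))"
    by (simp add: \<alpha> A_def plane_def)
  obtain U \<kappa> where "unit_speed_curve I A U \<kappa>"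
    and sled_U: "\<And>s. s \<in> I \<Longrightarrow> treadmill_sled \<alpha> s = plane (- (A s * cnj (U s)))"
    using unit_speed_curve_of_arc_length_curve [OF I arc [unfolded \<alpha>A]] unfolding \<alpha>A by metis
  then interpret unit_speed_curve I A U \<kappa>
    by blast
  have sled: "treadmill_sled \<alpha> s = plane (- M s)" if "s \<in> I" for s
    using sled_U [OF that] by (simp only: M_def)
  have surf: "helicoidal w x z = surface w"
    by (simp add: A_def)
  have i: "(\<exists>p. treadmill_sled \<alpha> ` I = {p} \<and> p $ 1 = 0 \<and> p \<noteq> 0) \<longleftrightarrow>
      (\<exists>k. k \<noteq> 0 \<and> (\<forall>s\<in>I. M s = \<i> * of_real k))" (is "?L \<longleftrightarrow> ?R")
  proof
    assume ?L
    then obtain p where p: "\<And>s. s \<in> I \<Longrightarrow> plane (- M s) = p" "p $ 1 = 0" "p \<noteq> 0"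
      using sled by (metis imageI singletonD)
    have "M s = \<i> * of_real (- p $ 2)" if "s \<in> I" for s
      using p(2) unfolding p(1) [OF that, symmetric] by (simp add: complex_eq_iff)
    moreover have "- p $ 2 \<noteq> 0"
      using p by (simp add: vec_eq_iff forall_2)
    ultimately show ?R
      by blast
  next
    assume ?R
    then obtain k where k: "k \<noteq> 0" "\<And>s. s \<in> I \<Longrightarrow> M s = \<i> * of_real k"
      by blast
    have "treadmill_sled \<alpha> ` I = {plane (- \<i> * of_real k)}"
      using I(3) by (auto simp: sled k(2))
    moreover have "plane (- \<i> * of_real k) \<noteq> 0"
      using k(1) by (simp add: vec_eq_iff forall_2)
    ultimately show ?L
      by (intro exI [of _ "plane (- \<i> * of_real k)"]) simp
  qed
  have ii: "treadmill_sled \<alpha> ` I \<subseteq> vertical_half_line c \<sigma> \<longleftrightarrow>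
      (\<forall>s\<in>I. \<exists>r\<ge>0. M s = - Complex c (\<sigma> * r))" for c \<sigma>
  proof -
    have "plane (- M s) \<in> vertical_half_line c \<sigma> \<longleftrightarrow> (\<exists>r\<ge>0. M s = - Complex c (\<sigma> * r))" for s
      by (auto simp: vertical_half_line_def vec_eq_iff forall_2 complex_eq_iff)
    then show ?thesis
      by (auto simp: sled)
  qed
  show ?thesis
    unfolding i ii surf
  proof (intro conjI allI impI)
    show "flat_surface_on I (surface w) \<longleftrightarrow>
        (\<exists>k. k \<noteq> 0 \<and> (\<forall>s\<in>I. M s = \<i> * of_real k)) \<or>
        (\<exists>c \<sigma>. c \<noteq> 0 \<and> \<sigma> \<in> {1, -1} \<and> (\<forall>s\<in>I. \<exists>r\<ge>0. M s = - Complex c (\<sigma> * r)))"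
      using w flat_cases by (simp add: flat_iff)
  next
    assume "\<exists>k. k \<noteq> 0 \<and> (\<forall>s\<in>I. M s = \<i> * of_real k)"
    then obtain k where k: "k \<noteq> 0" "\<And>s. s \<in> I \<Longrightarrow> M s = \<i> * of_real k"
      by blast
    show "\<exists>r>0. openin (top_of_set (round_cylinder r)) (surface_trace I (surface w)) \<and>
        (I = UNIV \<longrightarrow> surface_trace I (surface w) = round_cylinder r)"
      using surface_in_cylinder [OF k] k(1) by (intro exI [of _ "\<bar>k\<bar>"]) auto
  next
    fix c \<sigma> :: real
    assume "c \<noteq> 0 \<and> \<sigma> \<in> {1, -1} \<and> (\<forall>s\<in>I. \<exists>r\<ge>0. M s = - Complex c (\<sigma> * r))"
    then obtain a b \<eta> where a: "a \<noteq> 0" and \<eta>: "norm \<eta> = 1"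
      and s: "\<forall>s\<in>I. a * (- \<sigma> * s) + b > 0 \<and>
        A s = \<eta> * Complex (flat_profile a b (- \<sigma> * s) $ 1)
                          (flat_profile a b (- \<sigma> * s) $ 2)"
      using half_line_imp_flat_profile [of c \<sigma>] by metis
    obtain Q where "rotation_matrix Q" "\<And>v. Q *v v = plane (\<eta> * Complex (v$1) (v$2))"
      using rotation_of_unit_complex [OF \<eta>] by blast
    with a s show "\<exists>a b Q. a \<noteq> 0 \<and> rotation_matrix Q \<and>
        (\<forall>s\<in>I. a * (- \<sigma> * s) + b > 0 \<and> \<alpha> s = Q *v flat_profile a b (- \<sigma> * s))"
      unfolding \<alpha>A by metis
  qed
qed

end
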